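(* Let $(X,d,W)$ be a complete convex metric space and let $T,S:X\to X$ be such that $(T,S)$ is an $(a,\alpha,\lambda)$-enriched interpolative Kannan pair, where $a,\lambda\in[0,1)$ and $\alpha\in(0,1)$. Then the common fixed point problem of the pair $(T,S)$ has the limit shadowing property.
   Context: Metric spaces are nonempty. Convex structure: for a metric space $(X,d)$, a continuous function $W:X\times X\times[0,1]\to X$ is a convex structure on $X$ if for all $x,y\in X$ and $\lambda\in[0,1]$, $d(u,W(x,y;\lambda))\le \lambda d(u,x)+(1-\lambda)d(u,y)$ for every $u\in X$. Then $(X,d,W)$ is called a (Takahashi) convex metric space; it is complete if $(X,d)$ is complete. For $a,\lambda\in[0,1)$ and $\alpha\in(0,1)$, a pair $(T,S)$ of mappings $T,S:X\to X$ is an $(a,\alpha,\lambda)$-enriched interpolative Kannan pair if $$d(W(x,Tx;\lambda),W(y,Sy;\lambda))\le a\,[d(x,W(x,Tx;\lambda))]^{\alpha}\,[d(y,W(y,Sy;\lambda))]^{1-\alpha}$$ for all $x,y\in X$. The common fixed point problem of the pair $(T,S)$ has the limit shadowing property (with $\lambda$ the parameter of the pair) if for every sequence $\{x_n\}_{n=0}^\infty$ in $X$ with $\lim_{n\to\infty}d(W(x_n,Tx_n;\lambda),x_n)=0$ and $\lim_{n\to\infty}d(x_n,W(x_n,Sx_n;\lambda))=0$, there exists $z\in X$ such that $\lim_{n\to\infty}d(W(z,T^nz;\lambda),x_n)=0$ and $\lim_{n\to\infty}d(x_n,W(z,S^nz;\lambda))=0$. Here $T^n$ and $S^n$ denote $n$-fold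 iterates. *)

theory Defs
  imports "HOL-Analysis.Analysis"
begin

text \<open>Takahashi convex structure. The parameter type is \<open>real\<close>; only the values of \<open>W x y t\<close>
  with \<open>0 \<le> t \<le> 1\<close> are constrained.\<close>

definition convex_structure :: "('a::metric_space \<Rightarrow> 'a \<Rightarrow> real \<Rightarrow> 'a) \<Rightarrow> bool" where
  "convex_structure W \<longleftrightarrow>
     continuous_on (UNIV \<times> UNIV \<times> {0..1}) (\<lambda>(x, y, t). W x y t) \<and>
     (\<forall>x y. \<forall>t\<in>{0..1}. \<forall>u. dist u (W x y t) \<le> t * dist u x + (1 - t) * dist u y)"

text \<open>The exponents are only used in \<open>(0, 1)\<close>, where \<open>0 powr r = 0\<close> agrees with the usual real power.\<close>

definition enriched_interpolative_Kannan_pair ::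
    "('a::metric_space \<Rightarrow> 'a \<Rightarrow> real \<Rightarrow> 'a) \<Rightarrow> real \<Rightarrow> real \<Rightarrow> real \<Rightarrow> ('a \<Rightarrow> 'a) \<Rightarrow> ('a \<Rightarrow> 'a) \<Rightarrow> bool" where
  "enriched_interpolative_Kannan_pair W a \<alpha> lam T S \<longleftrightarrow>
     (\<forall>x y. dist (W x (T x) lam) (W y (S y) lam)
        \<le> a * (dist x (W x (T x) lam)) powr \<alpha> * (dist y (W y (S y) lam)) powr (1 - \<alpha>))"

definition limit_shadowing_property ::
    "('a::metric_space \<Rightarrow> 'a \<Rightarrow> real \<Rightarrow> 'a) \<Rightarrow> real \<Rightarrow> ('a \<Rightarrow> 'a) \<Rightarrow> ('a \<Rightarrow> 'a) \<Rightarrow> bool" where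
  "limit_shadowing_property W lam T S \<longleftrightarrow>
     (\<forall>x :: nat \<Rightarrow> 'a.
        (\<lambda>n. dist (W (x n) (T (x n)) lam) (x n)) \<longlonglongrightarrow> 0 \<longrightarrow>
        (\<lambda>n. dist (x n) (W (x n) (S (x n)) lam)) \<longlonglongrightarrow> 0 \<longrightarrow>
        (\<exists>z. (\<lambda>n. dist (W z ((T ^^ n) z) lam) (x n)) \<longlonglongrightarrow> 0 \<and>
             (\<lambda>n. dist (x n) (W z ((S ^^ n) z) lam)) \<longlonglongrightarrow> 0))"

end

theory Submission
  imports Defs
begin

text \<open>
  Put \<open>F x = W x (T x) lam\<close> and \<open>G y = W y (S y) lam\<close>. The Kannan condition bounds
  \<open>dist (F x) (G y)\<close> by \<open>a\<close> times a weighted geometric mean of the displacements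
  \<open>dist x (F x)\<close> and \<open>dist y (G y)\<close>. Two consequences carry the proof. First, a sequence
  along which both displacements vanish is Cauchy, since
  \<open>dist (x m) (x n) \<le> dist (x m) (F (x m)) + dist (F (x m)) (G (x n)) + dist (G (x n)) (x n)\<close>
  and a geometric mean of two small numbers is small. Second, its limit \<open>z\<close> is fixed by both
  \<open>F\<close> and \<open>G\<close>: with one argument fixed at \<open>z\<close> and the other running through the sequence,
  the bound still tends to zero (lemma \<open>interpolative_Kannan_common_fixed_limit\<close>).

  For \<open>lam < 1\<close>, the fixed points of \<open>F\<close> are exactly those of \<open>T\<close>, and likewise for \<open>G\<close>
  and \<open>S\<close> (lemma \<open>convex_structure_fixed_iff\<close>). Hence all iterates of \<open>T\<close> and \<open>S\<close> at \<open>z\<close> equal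
  \<open>z\<close>, both shadowing orbits are constant, and the shadowing claim is just \<open>x n \<longlonglongrightarrow> z\<close>.
\<close>

lemma powr_geometric_mean_le:
  fixes p q m \<alpha> :: real
  assumes "0 \<le> p" "p \<le> m" "0 \<le> q" "q \<le> m" "0 \<le> \<alpha>" "\<alpha> \<le> 1"
  shows "p powr \<alpha> * q powr (1 - \<alpha>) \<le> m"
proof -
  have "p powr \<alpha> * q powr (1 - \<alpha>) \<le> m powr \<alpha> * m powr (1 - \<alpha>)"
    using assms by (intro mult_mono powr_mono2) auto
  also have "\<dots> = m"
    using assms by (simp flip: powr_add)
  finally show ?thesis .
qed

text \<open>
  The points \<open>G (x n)\<close> approach \<open>z\<close> because they stay close to \<open>x n\<close>, and approach \<open>F z\<close> because
  the displacement of \<open>x n\<close> enters the bound with a positive power. The two exponents are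
  independent so that the lemma applies to both members of a Kannan pair, whose exponents trade
  places when the roles of the maps are exchanged.
\<close>

lemma fixed_point_of_vanishing_displacement:
  fixes F G :: "'a::metric_space \<Rightarrow> 'a" and a \<beta> \<gamma> :: real
  assumes bound: "\<And>y. dist (F z) (G y) \<le> a * dist z (F z) powr \<beta> * dist y (G y) powr \<gamma>"
    and "0 < \<gamma>" and xz: "x \<longlonglongrightarrow> z"
    and disp: "(\<lambda>n. dist (x n) (G (x n))) \<longlonglongrightarrow> 0"
  shows "F z = z"
proof -
  have "(\<lambda>n. dist (x n) (G (x n)) powr \<gamma>) \<longlonglongrightarrow> 0"
    using tendsto_powr2[OF disp tendsto_const[of \<gamma>]] \<open>0 < \<gamma>\<close> by simp
  then have "(\<lambda>n. a * dist z (F z) powr \<beta> * dist (x n) (G (x n)) powr \<gamma>) \<longlonglongrightarrow> 0"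
    by (rule tendsto_mult_right_zero)
  then have "(\<lambda>n. dist (F z) (G (x n))) \<longlonglongrightarrow> 0"
    by (rule tendsto_sandwich[OF _ _ tendsto_const, rotated 2])
      (use bound in auto)
  then have "(\<lambda>n. dist (x n) (G (x n)) + dist (F z) (G (x n))) \<longlonglongrightarrow> 0"
    using tendsto_add[OF disp] by fastforce
  then have "(\<lambda>n. dist (x n) (F z)) \<longlonglongrightarrow> 0"
    by (rule tendsto_sandwich[OF _ _ tendsto_const, rotated 2])
      (auto intro!: always_eventually dist_triangle2)
  then have "x \<longlonglongrightarrow> F z"
    by (rule iffD2[OF tendsto_dist_iff])
  then show ?thesis
    using xz LIMSEQ_unique by blast
qed

text \<open>
  Interpolation makes the bound uniform in both indices: as soon as both displacements are below
  \<open>\<delta>\<close>, so is their weighted geometric mean, whence the Cauchy estimate \<open>(2 + a) * \<delta>\<close>.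
\<close>

lemma interpolative_Kannan_common_fixed_limit:
  fixes F G :: "'a::complete_space \<Rightarrow> 'a" and a \<alpha> :: real
  assumes kannan: "\<And>x y. dist (F x) (G y) \<le> a * dist x (F x) powr \<alpha> * dist y (G y) powr (1 - \<alpha>)"
    and a: "0 \<le> a" and \<alpha>: "0 < \<alpha>" "\<alpha> < 1"
    and F0: "(\<lambda>n. dist (x n) (F (x n))) \<longlonglongrightarrow> 0"
    and G0: "(\<lambda>n. dist (x n) (G (x n))) \<longlonglongrightarrow> 0"
  obtains z where "x \<longlonglongrightarrow> z" "F z = z" "G z = z"
proof -
  have "Cauchy x"
  proof (rule metric_CauchyI)
    fix e :: real
    assume "0 < e"
    define \<delta> where "\<delta> = e / (2 + a)"
    have "0 < \<delta>"
      using \<open>0 < e\<close> a by (simp add: \<delta>_def)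
    have "(2 + a) * \<delta> = e"
      using a by (simp add: \<delta>_def)
    then have \<delta>: "\<delta> + a * \<delta> + \<delta> = e"
      by (simp add: algebra_simps)
    have "eventually (\<lambda>n. dist (x n) (F (x n)) < \<delta> \<and> dist (x n) (G (x n)) < \<delta>) sequentially"
      using order_tendstoD(2)[OF F0 \<open>0 < \<delta>\<close>] order_tendstoD(2)[OF G0 \<open>0 < \<delta>\<close>]
      by (rule eventually_conj)
    then obtain N where N: "\<And>n. n \<ge> N \<Longrightarrow> dist (x n) (F (x n)) < \<delta> \<and> dist (x n) (G (x n)) < \<delta>"
      by (auto simp: eventually_sequentially)
    have "dist (x m) (x n) < e" if "m \<ge> N" "n \<ge> N" for m n
    proof -
      have "dist (x m) (F (x m)) powr \<alpha> * dist (x n) (G (x n)) powr (1 - \<alpha>) \<le> \<delta>"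
        using N[OF \<open>m \<ge> N\<close>] N[OF \<open>n \<ge> N\<close>] \<alpha> by (intro powr_geometric_mean_le) auto
      then have "dist (F (x m)) (G (x n)) \<le> a * \<delta>"
        using order_trans[OF kannan[of "x m" "x n"]] a
        by (simp add: mult.assoc mult_left_mono)
      moreover have "dist (x m) (x n)
          \<le> dist (x m) (F (x m)) + dist (F (x m)) (G (x n)) + dist (x n) (G (x n))"
        using dist_triangle[of "x m" "x n" "F (x m)"] dist_triangle2[of "F (x m)" "x n" "G (x n)"]
        by linarith
      ultimately show ?thesis
        using N[OF \<open>m \<ge> N\<close>] N[OF \<open>n \<ge> N\<close>] \<delta> by linarith
    qed
    then show "\<exists>N. \<forall>m\<ge>N. \<forall>n\<ge>N. dist (x m) (x n) < e"
      by blast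
  qed
  then obtain z where xz: "x \<longlonglongrightarrow> z"
    using Cauchy_convergent convergentD by blast
  have "F z = z"
  proof (rule fixed_point_of_vanishing_displacement[OF _ _ xz G0])
    show "dist (F z) (G y) \<le> a * dist z (F z) powr \<alpha> * dist y (G y) powr (1 - \<alpha>)" for y
      by (rule kannan)
  qed (use \<alpha> in simp)
  moreover have "G z = z"
  proof (rule fixed_point_of_vanishing_displacement[OF _ \<alpha>(1) xz F0])
    show "dist (G z) (F y) \<le> a * dist z (G z) powr (1 - \<alpha>) * dist y (F y) powr \<alpha>" for y
      using kannan[of y z] by (simp add: dist_commute mult_ac)
  qed
  ultimately show ?thesis
    using xz that by blast
qed

text \<open>
  Seen from \<open>y\<close>, the point \<open>W x y t\<close> is at distance at most \<open>t * dist y x\<close>; for \<open>t < 1\<close> it can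
  therefore coincide with \<open>x\<close> only if \<open>y = x\<close>.
\<close>

lemma convex_structure_fixed_iff:
  assumes W: "convex_structure W" and t: "0 \<le> t" "t < 1"
  shows "W x y t = x \<longleftrightarrow> y = x"
proof
  have le: "dist u (W x y t) \<le> t * dist u x + (1 - t) * dist u y" for u x y
    using W t by (auto simp: convex_structure_def)
  show "y = x" if "W x y t = x"
  proof -
    have "(1 - t) * dist y x \<le> 0"
      using le[of y x y] that by (simp add: algebra_simps)
    then show ?thesis
      using t by (simp add: mult_le_0_iff)
  qed
  show "W x y t = x" if "y = x"
    using le[of x x x] that by simp
qed

theorem theorem3p2p2:
  fixes W :: "'a::complete_space \<Rightarrow> 'a \<Rightarrow> real \<Rightarrow> 'a"
    and T S :: "'a \<Rightarrow> 'a"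
    and a \<alpha> lam :: real
  assumes "convex_structure W"
    and "0 \<le> a" and "a < 1"
    and "0 \<le> lam" and "lam < 1"
    and "0 < \<alpha>" and "\<alpha> < 1"
    and "enriched_interpolative_Kannan_pair W a \<alpha> lam T S"
  shows "limit_shadowing_property W lam T S"
  unfolding limit_shadowing_property_def
proof (intro allI impI)
  fix x :: "nat \<Rightarrow> 'a"
  assume T0: "(\<lambda>n. dist (W (x n) (T (x n)) lam) (x n)) \<longlonglongrightarrow> 0"
    and S0: "(\<lambda>n. dist (x n) (W (x n) (S (x n)) lam)) \<longlonglongrightarrow> 0"
  note W_fixed = convex_structure_fixed_iff[OF assms(1,4,5)]
  obtain z where xz: "x \<longlonglongrightarrow> z" and fixed: "W z (T z) lam = z" "W z (S z) lam = z"
  proof (rule interpolative_Kannan_common_fixed_limit)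
    show "dist (W u (T u) lam) (W v (S v) lam)
        \<le> a * dist u (W u (T u) lam) powr \<alpha> * dist v (W v (S v) lam) powr (1 - \<alpha>)" for u v
      using assms(8) by (simp add: enriched_interpolative_Kannan_pair_def)
    show "(\<lambda>n. dist (x n) (W (x n) (T (x n)) lam)) \<longlonglongrightarrow> 0"
      using T0 by (simp add: dist_commute)
  qed (use assms S0 in auto)
  have "T z = z" "S z = z"
    using fixed by (simp_all add: W_fixed)
  then have "(T ^^ n) z = z" "(S ^^ n) z = z" for n
    by (induction n) auto
  then have "W z ((T ^^ n) z) lam = z" "W z ((S ^^ n) z) lam = z" for n
    by (simp_all add: W_fixed)
  moreover have "(\<lambda>n. dist (x n) z) \<longlonglongrightarrow> 0"
    using xz by (simp flip: tendsto_dist_iff)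
  ultimately show "\<exists>z. (\<lambda>n. dist (W z ((T ^^ n) z) lam) (x n)) \<longlonglongrightarrow> 0 \<and>
      (\<lambda>n. dist (x n) (W z ((S ^^ n) z) lam)) \<longlonglongrightarrow> 0"
    by (intro exI[of _ z]) (simp add: dist_commute)
qed

end
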